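(* Let $\mathcal{G}$ be a connected, undirected graph on $n$ nodes, let $w\in\mathbb{R}^n$ be a constant disturbance vector, let $K=\mathrm{diag}(k_1,\ldots,k_n)$ with all $k_i>0$, and let $M=m\mathrm{I}_n$ with $m>0$. Consider the multiagent system $$\dot x(t)=u(t)+w,\qquad x(0)=x_0\in\mathbb{R}^n,\quad t\ge 0,$$ with the controller $$u(t)=-\mathcal{L}(\mathcal{G})x(t)-\hat w(t),$$ $$\dot{\hat w}(t)=K\mathcal{Q}(\mathcal{G})\bigl(x(t)-\hat x(t)\bigr),\qquad \hat w(0)=\hat w_0\in\mathbb{R}^n,$$ $$\dot{\hat x}(t)=-\mathcal{L}(\mathcal{G})\hat x(t)+M\bigl(x(t)-\hat x(t)\bigr),\qquad \hat x(0)=\hat x_0\in\mathbb{R}^n,$$ where $\mathcal{Q}(\mathcal{G})=\mathrm{I}_n-\mathcal{S}(\mathcal{G})(\mathrm{I}_n+\mathcal{A}(\mathcal{G}))$, and let $\tilde w(t)=\hat w(t)-w$. Then the controller produces consensus, in the sense that $$\lim_{t\to\infty}\left( x(t)-\frac{\mathbf{1}_n}{n}\Bigl[\mathbf{1}_n^{\mathrm T}x_0-\mathbf{1}_n^{\mathrm T}\int_0^t\tilde w(\sigma)\,\mathrm{d}\sigma\Bigr]\right)=\mathbf{0}_n .$$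
   Context: The graph $\mathcal{G}$ is static, with nodes $\{1,\ldots,n\}$ and unweighted edges; $N_i$ is the number of neighbors of node $i$. $\mathcal{A}(\mathcal{G})$ is the $0$–$1$ adjacency matrix, $\mathcal{D}(\mathcal{G})=\mathrm{diag}(N_1,\ldots,N_n)$ the degree matrix, $\mathcal{L}(\mathcal{G})=\mathcal{D}(\mathcal{G})-\mathcal{A}(\mathcal{G})$ the Laplacian, and $\mathcal{S}(\mathcal{G})=\mathrm{diag}((N_1+1)^{-1},\ldots,(N_n+1)^{-1})$. $\mathrm{I}_n$ is the identity matrix; $\mathbf{1}_n$ and $\mathbf{0}_n$ are the all-ones and zero column vectors in $\mathbb{R}^n$. *)

theory Defs
  imports "HOL-Analysis.Analysis" "Graph_Theory.Graph_Theory"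
begin

definition neighbors :: "'n pair_pre_digraph \<Rightarrow> 'n \<Rightarrow> 'n set" where
  "neighbors G i = {j. (i, j) \<in> parcs G}"

definition diag_matrix :: "'a::zero ^ 'n \<Rightarrow> 'a ^ 'n ^ 'n" where
  "diag_matrix v = (\<chi> i j. if i = j then v $ i else 0)"

definition adjacency_matrix :: "'n::finite pair_pre_digraph \<Rightarrow> real ^ 'n ^ 'n" where
  "adjacency_matrix G = (\<chi> i j. if (i, j) \<in> parcs G then 1 else 0)"

definition degree_matrix :: "'n::finite pair_pre_digraph \<Rightarrow> real ^ 'n ^ 'n" where
  "degree_matrix G = diag_matrix (\<chi> i. real (card (neighbors G i)))"

definition laplacian_matrix :: "'n::finite pair_pre_digraph \<Rightarrow> real ^ 'n ^ 'n" where
  "laplacian_matrix G = degree_matrix G - adjacency_matrix G"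

definition S_matrix :: "'n::finite pair_pre_digraph \<Rightarrow> real ^ 'n ^ 'n" where
  "S_matrix G = diag_matrix (\<chi> i. inverse (real (card (neighbors G i)) + 1))"

definition Q_matrix :: "'n::finite pair_pre_digraph \<Rightarrow> real ^ 'n ^ 'n" where
  "Q_matrix G = mat 1 - S_matrix G ** (mat 1 + adjacency_matrix G)"

end

theory Submission
  imports Defs
begin

text \<open>
  Write \<open>L\<close> for the Laplacian. Since \<open>N_i + 1\<close> is the \<open>i\<close>-th diagonal entry of the inverse of \<open>S\<close>,
  the matrix \<open>Q = I - S (I + A)\<close> is just \<open>S L\<close>. With \<open>e = x - x_hat\<close> and the positive diagonal
  matrix \<open>P = K S\<close> the closed loop becomes
  \<open>x' = - L x - w_tilde\<close>, \<open>w_tilde' = P L e\<close>, \<open>e' = - L e - w_tilde - m e\<close>.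
  Here \<open>L\<close> is symmetric, kills the constant vectors, and, by connectedness, is positive definite
  on the vectors with mean zero (\<open>laplacian_spectral_gap\<close>).

  With \<open>R\<close> the inverse of \<open>P\<close>, the energy \<open>e \<bullet> L e + w_tilde \<bullet> R w_tilde\<close> is nonincreasing, but it
  neither controls \<open>x\<close> nor dissipates \<open>w_tilde\<close>. Two repairs turn it into a strict Lyapunov function.
  First, \<open>1 \<bullet> R w_tilde\<close> is conserved, so \<open>w_tilde\<close> is replaced by its shift
  \<open>v = w_tilde - q 1\<close> with \<open>1 \<bullet> R v = 0\<close>, which is controlled by its mean-free part; the part
  \<open>q 1\<close> stays constant, but it is invisible to \<open>L\<close> and to deviations from the mean. Second, a
  multiple of \<open>e \<bullet> L v\<close>, whose derivative contains \<open>- v \<bullet> L v\<close>, and the squared norm of the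
  deviation of \<open>x\<close> from its mean are added. The resulting function decays exponentially
  (\<open>strict_lyapunov\<close>), hence so does the deviation of \<open>x\<close>
  (\<open>deviation_tendsto_zero\<close>).

  Finally \<open>1 \<bullet> L x = 0\<close>, so \<open>1 \<bullet> x\<close> has derivative \<open>- 1 \<bullet> w_tilde\<close>; integrating shows that the
  vector subtracted from \<open>x\<close> in the theorem is the mean of \<open>x\<close> times the vector
  \<open>1\<close>.
\<close>

section \<open>Deviation from the mean\<close>

definition deviation :: "real ^ 'n \<Rightarrow> real ^ 'n::finite" where
  "deviation v = v - ((1 \<bullet> v) / real CARD('n)) *\<^sub>R 1"

lemma inner_one_one: "(1 :: real ^ 'n::finite) \<bullet> 1 = real CARD('n)"
  by (simp add: inner_vec_def)

lemma inner_one_deviation: "1 \<bullet> deviation v = 0"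
  by (simp add: deviation_def inner_diff_right inner_one_one)

text \<open>
  The deviation is the orthogonal projection onto the complement of the constant vectors, so in an
  inner product with a deviation the other factor may be projected as well.
\<close>

lemma inner_deviation_left: "deviation u \<bullet> v = deviation u \<bullet> deviation v"
  using inner_one_deviation[of u]
  by (simp add: deviation_def[of v] inner_diff_right inner_commute)

lemma norm_deviation_le: "norm (deviation v) \<le> norm v"
proof -
  have "deviation v \<bullet> v = (norm (deviation v))\<^sup>2"
    by (simp add: inner_deviation_left[of v v] dot_square_norm)
  then show ?thesis
    using norm_cauchy_schwarz[of "deviation v" v]
    by (cases "deviation v = 0") (auto simp: power2_eq_square)
qed

lemma bounded_linear_deviation: "bounded_linear deviation"
  unfolding linear_conv_bounded_linear[symmetric]
  by (rule linearI) (simp_all add: deviation_def inner_add_right algebra_simps add_divide_distrib)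

section \<open>Diagonal matrices\<close>

lemma diag_matrix_mult_nth: "(diag_matrix d *v v) $ i = d $ i * v $ i"
  for d v :: "real ^ 'n::finite"
  by (simp add: diag_matrix_def matrix_vector_mult_def if_distrib if_distribR cong: if_cong)

lemma inner_diag_matrix: "u \<bullet> (diag_matrix d *v v) = (diag_matrix d *v u) \<bullet> v"
  for d u v :: "real ^ 'n::finite"
  by (simp add: inner_vec_def diag_matrix_mult_nth mult_ac)

lemma diag_matrix_coercive:
  fixes d :: "real ^ 'n::finite"
  assumes "\<And>i. d $ i > 0"
  obtains c where "c > 0" "\<And>v. c * (norm v)\<^sup>2 \<le> v \<bullet> (diag_matrix d *v v)"
proof (rule that[of "Min (range (($) d))"])
  show "Min (range (($) d)) > 0" using assms by simp
  fix v :: "real ^ 'n"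
  have "Min (range (($) d)) * (norm v)\<^sup>2 = (\<Sum>i\<in>UNIV. Min (range (($) d)) * (v $ i)\<^sup>2)"
    unfolding power2_norm_eq_inner by (simp add: sum_distrib_left inner_vec_def power2_eq_square)
  also have "\<dots> \<le> (\<Sum>i\<in>UNIV. d $ i * (v $ i)\<^sup>2)"
    by (intro sum_mono mult_right_mono Min_le) auto
  also have "\<dots> = v \<bullet> (diag_matrix d *v v)"
    by (simp add: inner_vec_def diag_matrix_mult_nth power2_eq_square mult_ac)
  finally show "Min (range (($) d)) * (norm v)\<^sup>2 \<le> v \<bullet> (diag_matrix d *v v)" .
qed

section \<open>The Laplacian of a connected graph\<close>

definition arc_weight :: "'n pair_pre_digraph \<Rightarrow> 'n \<Rightarrow> 'n \<Rightarrow> real" where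
  "arc_weight G i j = (if (i, j) \<in> parcs G then 1 else 0)"

lemma sum_arc_weight: "(\<Sum>j\<in>UNIV. arc_weight G i j) = real (card (neighbors G i))"
  for G :: "'n::finite pair_pre_digraph"
  by (simp add: arc_weight_def neighbors_def flip: sum.inter_filter)

lemma adjacency_mult_nth:
  "(adjacency_matrix G *v v) $ i = (\<Sum>j\<in>UNIV. arc_weight G i j * v $ j)"
  by (simp add: adjacency_matrix_def matrix_vector_mult_def arc_weight_def)

lemma laplacian_mult_nth:
  "(laplacian_matrix G *v v) $ i = (\<Sum>j\<in>UNIV. arc_weight G i j * (v $ i - v $ j))"
  by (simp add: laplacian_matrix_def degree_matrix_def matrix_vector_mult_diff_rdistrib
      diag_matrix_mult_nth adjacency_mult_nth right_diff_distrib sum_subtractf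
      flip: sum_arc_weight sum_distrib_right)

lemma laplacian_mult_one: "laplacian_matrix G *v 1 = 0"
  by (simp add: vec_eq_iff laplacian_mult_nth)

text \<open>
  The Dirichlet form of the graph: averaging the double sum with its transpose turns the one-sided
  differences of the Laplacian into products of differences along arcs. Symmetry and positivity of
  the Laplacian are then visible.
\<close>

lemma inner_laplacian:
  fixes G :: "'n::finite pair_pre_digraph"
  assumes "sym (parcs G)"
  shows "u \<bullet> (laplacian_matrix G *v v) =
    (\<Sum>i\<in>UNIV. \<Sum>j\<in>UNIV. arc_weight G i j * ((u $ i - u $ j) * (v $ i - v $ j))) / 2"
proof -
  have sym: "arc_weight G i j = arc_weight G j i" for i j
    using assms by (auto simp: arc_weight_def dest: symD)
  define F where "F i j = u $ i * (arc_weight G i j * (v $ i - v $ j))" for i j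
  have "u \<bullet> (laplacian_matrix G *v v) = (\<Sum>i\<in>UNIV. \<Sum>j\<in>UNIV. F i j)"
    by (simp add: inner_vec_def laplacian_mult_nth sum_distrib_left F_def)
  moreover from this have "u \<bullet> (laplacian_matrix G *v v) = (\<Sum>i\<in>UNIV. \<Sum>j\<in>UNIV. F j i)"
    by (subst sum.swap)
  ultimately have "2 * (u \<bullet> (laplacian_matrix G *v v)) = (\<Sum>i\<in>UNIV. \<Sum>j\<in>UNIV. F i j + F j i)"
    by (simp add: sum.distrib)
  also have "\<dots> = (\<Sum>i\<in>UNIV. \<Sum>j\<in>UNIV. arc_weight G i j * ((u $ i - u $ j) * (v $ i - v $ j)))"
    by (intro sum.cong refl) (simp add: F_def sym algebra_simps)
  finally show ?thesis by simp
qed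

lemma laplacian_selfadjoint:
  assumes "sym (parcs G)"
  shows "u \<bullet> (laplacian_matrix G *v v) = (laplacian_matrix G *v u) \<bullet> v"
  by (simp add: inner_laplacian[OF assms] inner_commute[of "laplacian_matrix G *v u"] mult.commute)

lemma sym_parcs_pair_graph:
  assumes "pair_graph G"
  shows "sym (parcs G)"
proof -
  interpret pair_graph G by fact
  show ?thesis using pair_sym_arcs by (simp add: symmetric_def)
qed

lemma connected_imp_constant:
  assumes sym: "sym (parcs G)" and V: "pverts G = UNIV"
    and conn: "Digraph_Component.connected (with_proj G)"
    and arc: "\<And>i j. (i, j) \<in> parcs G \<Longrightarrow> f i = f j"
  shows "f i = f j"
proof -
  have "i \<rightarrow>\<^sup>*\<^bsub>with_proj (mk_symmetric (with_proj G))\<^esub> j"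
    using conn V by (simp add: Digraph_Component.connected_def strongly_connected_def)
  then show ?thesis unfolding reachable_def
  proof (induction rule: rtrancl_on_induct)
    case (step a b)
    then have "(a, b) \<in> parcs G \<or> (b, a) \<in> parcs G"
      by (auto simp: parcs_mk_symmetric)
    with arc step.IH show ?case by metis
  qed simp
qed

text \<open>
  If the Dirichlet form vanishes at \<open>v\<close>, then \<open>v\<close> is constant along every arc, hence constant, and
  a constant vector with mean zero is zero.
\<close>

lemma laplacian_pos:
  fixes G :: "'n::finite pair_pre_digraph"
  assumes sym: "sym (parcs G)" and V: "pverts G = UNIV"
    and conn: "Digraph_Component.connected (with_proj G)"
    and v: "1 \<bullet> v = 0" "v \<noteq> 0"
  shows "v \<bullet> (laplacian_matrix G *v v) > 0"
proof (rule ccontr)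
  let ?T = "\<lambda>i j. arc_weight G i j * ((v $ i - v $ j) * (v $ i - v $ j))"
  have nonneg: "?T i j \<ge> 0" for i j
    by (simp add: arc_weight_def)
  assume "\<not> ?thesis"
  then have "(\<Sum>i\<in>UNIV. \<Sum>j\<in>UNIV. ?T i j) \<le> 0"
    by (simp add: inner_laplacian[OF sym])
  moreover have "0 \<le> (\<Sum>i\<in>UNIV. \<Sum>j\<in>UNIV. ?T i j)"
    by (intro sum_nonneg nonneg)
  ultimately have "(\<Sum>i\<in>UNIV. \<Sum>j\<in>UNIV. ?T i j) = 0" by linarith
  then have T0: "?T i j = 0" for i j
    by (simp add: sum_nonneg_eq_0_iff nonneg sum_nonneg)
  have "v $ i = v $ j" if "(i, j) \<in> parcs G" for i j
    using T0[of i j] that by (simp add: arc_weight_def)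
  then have const: "v $ i = v $ j" for i j
    by (rule connected_imp_constant[OF sym V conn, of "\<lambda>i. v $ i"])
  have "v $ i = 0" for i
  proof -
    have "(\<Sum>j\<in>UNIV. v $ j) = (\<Sum>j\<in>(UNIV::'n set). v $ i)"
      using const by (intro sum.cong) auto
    with v(1) show ?thesis by (simp add: inner_vec_def)
  qed
  with v(2) show False by (simp add: vec_eq_iff)
qed

text \<open>
  The constant is the minimum of the Dirichlet form on the compact set of mean-free unit vectors.
\<close>

lemma laplacian_spectral_gap:
  fixes G :: "'n::finite pair_pre_digraph"
  assumes sym: "sym (parcs G)" and V: "pverts G = UNIV"
    and conn: "Digraph_Component.connected (with_proj G)"
  obtains \<mu> where "\<mu> > 0"
    "\<And>v. 1 \<bullet> v = 0 \<Longrightarrow> \<mu> * (norm v)\<^sup>2 \<le> v \<bullet> (laplacian_matrix G *v v)"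
proof (cases "\<exists>v :: real ^ 'n. 1 \<bullet> v = 0 \<and> norm v = 1")
  case True
  let ?q = "\<lambda>v. v \<bullet> (laplacian_matrix G *v v)"
  let ?C = "{v :: real ^ 'n. 1 \<bullet> v = 0} \<inter> sphere 0 1"
  have "compact ?C"
    by (intro closed_Int_compact closed_hyperplane compact_sphere)
  moreover have "?C \<noteq> {}" using True by auto
  moreover have "continuous_on ?C ?q"
    by (intro continuous_intros linear_continuous_on matrix_vector_mul_bounded_linear)
  ultimately obtain z where z: "z \<in> ?C" and min: "\<And>v. v \<in> ?C \<Longrightarrow> ?q z \<le> ?q v"
    using continuous_attains_inf[of ?C ?q] by blast
  show ?thesis
  proof (rule that[of "?q z"])
    show "?q z > 0" using z by (intro laplacian_pos[OF assms]) auto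
    fix v :: "real ^ 'n" assume v: "1 \<bullet> v = 0"
    show "?q z * (norm v)\<^sup>2 \<le> ?q v"
    proof (cases "v = 0")
      case False
      define s where "s = v /\<^sub>R norm v"
      have "?q z \<le> ?q s" using False v by (intro min) (simp add: s_def)
      also have "?q s = ?q v / (norm v)\<^sup>2"
        by (simp add: s_def matrix_vector_mult_scaleR power2_eq_square divide_inverse)
      finally show ?thesis using False by (simp add: field_simps)
    qed simp
  qed
next
  \<comment> \<open>This case is a graph with a single node: every mean-free vector is zero.\<close>
  case False
  have "v = 0" if "1 \<bullet> v = 0" for v :: "real ^ 'n"
  proof (rule ccontr)
    assume "v \<noteq> 0"
    then have "1 \<bullet> (v /\<^sub>R norm v) = 0 \<and> norm (v /\<^sub>R norm v) = 1" using that by simp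
    with False show False by blast
  qed
  then show ?thesis by (intro that[of 1]) fastforce+
qed

text \<open>
  The diagonal of the inverse of \<open>S\<close> is \<open>N_i + 1\<close>, so \<open>I = S (D + I)\<close>, and \<open>I - S (I + A)\<close> collapses
  to \<open>S (D - A)\<close>.
\<close>

lemma Q_matrix_eq: "Q_matrix G = S_matrix G ** laplacian_matrix G"
proof -
  have "Q_matrix G *v v = (S_matrix G ** laplacian_matrix G) *v v" for v
  proof -
    have "(Q_matrix G *v v) $ i = ((S_matrix G ** laplacian_matrix G) *v v) $ i" for i
    proof -
      define N where "N = real (card (neighbors G i))"
      have "N + 1 \<noteq> 0" by (simp add: N_def add_nonneg_eq_0_iff)
      then show ?thesis
        by (simp add: Q_matrix_def matrix_vector_mult_diff_rdistrib matrix_vector_mult_add_rdistrib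
            S_matrix_def diag_matrix_mult_nth laplacian_matrix_def degree_matrix_def
            flip: matrix_vector_mul_assoc N_def) (simp add: field_simps)
    qed
    then show ?thesis by (simp add: vec_eq_iff)
  qed
  then show ?thesis using matrix_eq by blast
qed

section \<open>Derivatives and exponential decay\<close>

lemma has_real_derivative_inner:
  fixes f g :: "real \<Rightarrow> 'a::real_inner"
  assumes "(f has_vector_derivative f') (at t within T)"
    and "(g has_vector_derivative g') (at t within T)"
  shows "((\<lambda>t. f t \<bullet> g t) has_real_derivative f t \<bullet> g' + f' \<bullet> g t) (at t within T)"
  using bounded_bilinear.has_vector_derivative[OF bounded_bilinear_inner assms]
  by (simp add: has_real_derivative_iff_has_vector_derivative)

lemma has_vector_derivative_matrix_mult:
  fixes A :: "real ^ 'n::finite ^ 'n" 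
  assumes "(f has_vector_derivative f') F"
  shows "((\<lambda>t. A *v f t) has_vector_derivative A *v f') F"
  by (rule bounded_linear.has_vector_derivative[OF matrix_vector_mul_bounded_linear assms])

text \<open>
  The differential form of Gronwall's inequality: \<open>W t * exp (\<kappa> * t)\<close> is nonincreasing.
\<close>

lemma exponential_decay:
  fixes W W' :: "real \<Rightarrow> real"
  assumes deriv: "\<And>t. t \<ge> 0 \<Longrightarrow> (W has_real_derivative W' t) (at t within {0..})"
    and le: "\<And>t. t \<ge> 0 \<Longrightarrow> W' t \<le> - \<kappa> * W t"
    and t: "t \<ge> 0"
  shows "W t \<le> W 0 * exp (- \<kappa> * t)"
proof -
  let ?F = "\<lambda>s. W s * exp (\<kappa> * s)"
  have d: "(?F has_real_derivative (W' s + \<kappa> * W s) * exp (\<kappa> * s)) (at s within {0..})"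
    if "s \<ge> 0" for s
    by (rule derivative_eq_intros refl deriv[OF that] | simp add: algebra_simps)+
  have "?F t \<le> ?F 0"
  proof (rule DERIV_nonpos_imp_decreasing_open[OF t])
    fix s :: real assume s: "0 < s" "s < t"
    have "at s within {0..} = at s"
      using s by (intro at_within_interior) (simp add: interior_real_atLeast)
    then show "\<exists>y. DERIV ?F s :> y \<and> y \<le> 0"
      using d[of s] le[of s] s by (auto intro!: exI mult_nonpos_nonneg)
  next
    have "continuous_on {0..} ?F"
      by (rule DERIV_continuous_on) (use d in auto)
    then show "continuous_on {0..t} ?F" by (rule continuous_on_subset) auto
  qed
  then show ?thesis by (simp add: exp_minus field_simps)
qed

section \<open>A strict Lyapunov function\<close>

text \<open>
  The stability argument uses of the graph only these properties of its Laplacian; \<open>\<mu>\<close> is a lower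
  bound for the algebraic connectivity.
\<close>

locale laplacian_like =
  fixes L :: "real ^ 'n::finite ^ 'n" and \<mu> :: real
  assumes selfadjoint: "u \<bullet> (L *v v) = (L *v u) \<bullet> v"
    and mult_one: "L *v 1 = 0"
    and gap_pos: "\<mu> > 0"
    and gap: "1 \<bullet> v = 0 \<Longrightarrow> \<mu> * (norm v)\<^sup>2 \<le> v \<bullet> (L *v v)"
begin

lemma mult_deviation: "L *v deviation v = L *v v"
  by (simp add: deviation_def matrix_vector_mult_diff_distrib matrix_vector_mult_scaleR mult_one)

lemma inner_one_mult: "1 \<bullet> (L *v v) = 0"
  by (simp add: selfadjoint mult_one)

lemma inner_mult_deviation: "u \<bullet> (L *v v) = deviation u \<bullet> (L *v deviation v)"
  by (metis mult_deviation selfadjoint)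

lemma gap_deviation: "\<mu> * (norm (deviation v))\<^sup>2 \<le> v \<bullet> (L *v v)"
  using gap[OF inner_one_deviation, of v] by (simp flip: inner_mult_deviation)

text \<open>
  Together with \<open>gap_deviation\<close>, these upper bounds allow every term of the Lyapunov function and of
  its derivative to be estimated by the norms of the deviations alone.
\<close>

lemma bound_deviation:
  obtains B where "B > 0" "\<And>v. norm (L *v v) \<le> B * norm (deviation v)"
    "\<And>u v. \<bar>u \<bullet> (L *v v)\<bar> \<le> B * norm (deviation u) * norm (deviation v)"
proof -
  obtain B where B: "B > 0" "\<And>v. norm (L *v v) \<le> norm v * B"
    using bounded_linear.pos_bounded[OF matrix_vector_mul_bounded_linear] by blast
  have *: "norm (L *v v) \<le> B * norm (deviation v)" for v
    using B(2)[of "deviation v"] by (simp add: mult_deviation mult.commute)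
  have "\<bar>u \<bullet> (L *v v)\<bar> \<le> B * norm (deviation u) * norm (deviation v)" for u v
  proof -
    have "\<bar>u \<bullet> (L *v v)\<bar> = \<bar>deviation u \<bullet> (L *v v)\<bar>"
      by (simp add: inner_mult_deviation[of u] mult_deviation)
    also have "\<dots> \<le> norm (deviation u) * norm (L *v v)" by (rule Cauchy_Schwarz_ineq2)
    also have "\<dots> \<le> norm (deviation u) * (B * norm (deviation v))"
      by (intro mult_left_mono *) simp
    finally show ?thesis by (simp add: mult_ac)
  qed
  with B(1) * show ?thesis by (rule that)
qed

text \<open>
  The second inequality is pure algebra: its left-hand side is what the chain rule gives for the
  derivative of the function on the right along \<open>y' = - L y - v\<close>, \<open>v' = P L e\<close>,
  \<open>e' = - L e - v - m e\<close>, when \<open>R\<close> is inverse to \<open>P\<close>.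

  Put \<open>a\<close>, \<open>b\<close>, \<open>d\<close> for the norms of the deviations of \<open>e\<close>, \<open>v\<close>, \<open>y\<close>. The constants are chosen one
  after the other. The \<open>y\<close>-part gives \<open>- \<mu> d^2\<close> at the price of \<open>b^2 / \<mu>\<close>; the weight \<open>S\<close> of the
  cross term is taken so large that its dissipation \<open>- S \<mu> b^2 / 2\<close> pays for this with \<open>b^2\<close> to spare;
  this costs at most \<open>C a^2\<close>, which the damping \<open>- 2 A m (e \<bullet> L e)\<close> of the energy covers once \<open>A\<close> is
  large enough. The same \<open>A\<close> makes the energy dominate the indefinite cross term, so that the
  function is bounded below by \<open>d^2\<close>.

  The hypothesis \<open>1 \<bullet> R v = 0\<close> is what allows the function to be bounded above by
  \<open>D (a^2 + b^2 + d^2)\<close>: it says that subtracting a multiple of \<open>1\<close> from \<open>v\<close> cannot decrease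
  \<open>v \<bullet> R v\<close>, so this quantity is at most its value at the deviation of \<open>v\<close>.
\<close>

lemma strict_lyapunov:
  fixes P R :: "real ^ 'n ^ 'n" and m c :: real
  assumes m: "m > 0" and c: "c > 0"
    and R_sym: "\<And>u v. u \<bullet> (R *v v) = (R *v u) \<bullet> v"
    and R_pos: "\<And>v. c * (norm v)\<^sup>2 \<le> v \<bullet> (R *v v)"
  obtains A S \<kappa> :: real where "\<kappa> > 0"
    "\<And>e v y :: real ^ 'n. (norm (deviation y))\<^sup>2
       \<le> A * (e \<bullet> (L *v e) + v \<bullet> (R *v v)) + S * (e \<bullet> (L *v v)) + y \<bullet> deviation y"
    "\<And>e v y. 1 \<bullet> (R *v v) = 0 \<Longrightarrow>
       A * (- 2 * ((L *v e) \<bullet> (L *v e)) - 2 * m * (e \<bullet> (L *v e)))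
       + S * ((P *v (L *v e)) \<bullet> (L *v e) - (L *v e + v + m *\<^sub>R e) \<bullet> (L *v v))
       - 2 * ((L *v y + v) \<bullet> deviation y)
       \<le> - \<kappa> * (A * (e \<bullet> (L *v e) + v \<bullet> (R *v v)) + S * (e \<bullet> (L *v v)) + y \<bullet> deviation y)"
proof -
  obtain B where B: "B > 0" and nL: "\<And>v. norm (L *v v) \<le> B * norm (deviation v)"
    and iL: "\<And>u v. \<bar>u \<bullet> (L *v v)\<bar> \<le> B * norm (deviation u) * norm (deviation v)"
    by (rule bound_deviation) blast
  obtain p where p: "p > 0" "\<And>v. norm (P *v v) \<le> norm v * p"
    using bounded_linear.pos_bounded[OF matrix_vector_mul_bounded_linear] by blast
  obtain r where r: "r > 0" "\<And>v. norm (R *v v) \<le> norm v * r"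
    using bounded_linear.pos_bounded[OF matrix_vector_mul_bounded_linear] by blast
  define g where "g = B\<^sup>2 + m * B"
  define S where "S = 2 / \<mu> * (1 / \<mu> + 1)"
  define C where "C = S * (p * B\<^sup>2 + g\<^sup>2 / (2 * \<mu>))"
  define A where "A = (C + 1) / (2 * m * \<mu>) + S * B / (2 * \<mu>) + S * B / (2 * c)"
  define D where "D = A * B + A * r + S * B / 2 + 1"
  define \<kappa> where "\<kappa> = min 1 \<mu> / D"
  note \<mu> = gap_pos
  have S: "S > 0" using \<mu> by (simp add: S_def add_pos_pos)
  have C: "C \<ge> 0" using S \<mu> p by (simp add: C_def)
  have A1: "A * (2 * m * \<mu>) \<ge> C + 1" and A2: "A * \<mu> \<ge> S * B / 2" and A3: "A * c \<ge> S * B / 2"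
    using \<mu> m c S B C by (simp_all add: A_def field_simps add_nonneg_nonneg)
  have A: "A > 0"
  proof -
    have "S * B / 2 > 0" using S B by simp
    with A2 have "A * \<mu> > 0" by linarith
    with \<mu> show ?thesis by (simp add: zero_less_mult_iff)
  qed
  have D: "D > 0" using A B r S by (auto simp: D_def intro!: add_pos_pos)
  show ?thesis
  proof (rule that[of \<kappa> A S])
    show "\<kappa> > 0" using \<mu> D by (simp add: \<kappa>_def)
  next
    fix e v y :: "real ^ 'n"
    define a b d where "a = norm (deviation e)" and "b = norm (deviation v)"
      and "d = norm (deviation y)"
    have nn: "a \<ge> 0" "b \<ge> 0" "d \<ge> 0" by (simp_all add: a_def b_def d_def)
    have ee: "\<mu> * a\<^sup>2 \<le> e \<bullet> (L *v e)" "e \<bullet> (L *v e) \<le> B * a\<^sup>2"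
      using gap_deviation[of e] iL[of e e] by (simp_all add: a_def power2_eq_square mult.assoc)
    have vv: "\<mu> * b\<^sup>2 \<le> v \<bullet> (L *v v)"
      using gap_deviation[of v] by (simp add: b_def)
    have yy: "\<mu> * d\<^sup>2 \<le> y \<bullet> (L *v y)"
      using gap_deviation[of y] by (simp add: d_def)
    have ev: "\<bar>e \<bullet> (L *v v)\<bar> \<le> B * (a * b)"
      using iL[of e v] by (simp add: a_def b_def mult.assoc)
    have ab: "a * b \<le> (a\<^sup>2 + b\<^sup>2) / 2"
      using sum_squares_bound[of a b] by simp
    have dy: "y \<bullet> deviation y = d\<^sup>2"
      using inner_deviation_left[of y y] by (simp add: d_def dot_square_norm inner_commute)
    have R1: "c * b\<^sup>2 \<le> v \<bullet> (R *v v)"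
    proof -
      have "c * b\<^sup>2 \<le> c * (norm v)\<^sup>2"
        using c norm_deviation_le[of v] by (intro mult_left_mono power_mono) (auto simp: b_def)
      then show ?thesis using R_pos[of v] by linarith
    qed
    have Sev: "\<bar>S * (e \<bullet> (L *v v))\<bar> \<le> S * B / 2 * a\<^sup>2 + S * B / 2 * b\<^sup>2"
    proof -
      have "\<bar>e \<bullet> (L *v v)\<bar> \<le> B * ((a\<^sup>2 + b\<^sup>2) / 2)"
        using ev mult_left_mono[OF ab, of B] B by linarith
      from mult_left_mono[OF this, of S] S show ?thesis
        by (simp add: abs_mult algebra_simps add_divide_distrib)
    qed
    let ?W = "A * (e \<bullet> (L *v e) + v \<bullet> (R *v v)) + S * (e \<bullet> (L *v v)) + y \<bullet> deviation y"
    have "A * (e \<bullet> (L *v e)) \<ge> S * B / 2 * a\<^sup>2"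
    proof -
      have "S * B / 2 * a\<^sup>2 \<le> A * \<mu> * a\<^sup>2"
        by (rule mult_right_mono[OF A2]) simp
      also have "\<dots> \<le> A * (e \<bullet> (L *v e))"
        using mult_left_mono[OF ee(1), of A] A by (simp add: mult.assoc)
      finally show ?thesis .
    qed
    moreover have "A * (v \<bullet> (R *v v)) \<ge> S * B / 2 * b\<^sup>2"
    proof -
      have "S * B / 2 * b\<^sup>2 \<le> A * c * b\<^sup>2"
        by (rule mult_right_mono[OF A3]) simp
      also have "\<dots> \<le> A * (v \<bullet> (R *v v))"
        using mult_left_mono[OF R1, of A] A by (simp add: mult.assoc)
      finally show ?thesis .
    qed
    ultimately show "(norm (deviation y))\<^sup>2 \<le> ?W"
      using Sev unfolding dy d_def[symmetric] distrib_left by linarith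

    assume orth: "1 \<bullet> (R *v v) = 0"
    have R2: "v \<bullet> (R *v v) \<le> r * b\<^sup>2"
    proof -
      define s where "s = (1 \<bullet> v) / real CARD('n)"
      have dv: "deviation v = v - s *\<^sub>R 1" by (simp add: deviation_def s_def)
      have "deviation v \<bullet> (R *v deviation v) = v \<bullet> (R *v v) + s\<^sup>2 * (1 \<bullet> (R *v 1))"
        using orth R_sym[of v 1]
        by (simp add: dv matrix_vector_mult_diff_distrib matrix_vector_mult_scaleR
            inner_diff_left inner_diff_right inner_commute power2_eq_square)
      moreover have "1 \<bullet> (R *v 1) \<ge> 0"
        using R_pos[of 1] c by (smt (verit) mult_nonneg_nonneg zero_le_power2)
      ultimately have "v \<bullet> (R *v v) \<le> deviation v \<bullet> (R *v deviation v)" by simp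
      also have "\<dots> \<le> norm (deviation v) * norm (R *v deviation v)"
        by (rule norm_cauchy_schwarz)
      also have "\<dots> \<le> b * (b * r)"
        unfolding b_def by (intro mult_left_mono r) simp
      finally show ?thesis by (simp add: power2_eq_square mult_ac)
    qed
    have W_le: "?W \<le> D * (a\<^sup>2 + b\<^sup>2 + d\<^sup>2)"
    proof -
      have 1: "A * (e \<bullet> (L *v e)) \<le> A * B * a\<^sup>2"
        using mult_left_mono[OF ee(2), of A] A by (simp add: mult.assoc)
      have 2: "A * (v \<bullet> (R *v v)) \<le> A * r * b\<^sup>2"
        using mult_left_mono[OF R2, of A] A by (simp add: mult.assoc)
      have "?W \<le> (A * B + S * B / 2) * a\<^sup>2 + (A * r + S * B / 2) * b\<^sup>2 + 1 * d\<^sup>2"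
        using 1 2 Sev unfolding dy distrib_left distrib_right by linarith
      also have "\<dots> \<le> D * a\<^sup>2 + D * b\<^sup>2 + D * d\<^sup>2"
        using A B r S by (intro add_mono mult_right_mono) (auto simp: D_def)
      finally show ?thesis by (simp add: algebra_simps)
    qed
    have LL: "\<bar>(L *v e) \<bullet> (L *v v)\<bar> \<le> B\<^sup>2 * (a * b)"
    proof -
      have "\<bar>(L *v e) \<bullet> (L *v v)\<bar> \<le> norm (L *v e) * norm (L *v v)"
        by (rule Cauchy_Schwarz_ineq2)
      also have "\<dots> \<le> (B * a) * (B * b)"
        unfolding a_def b_def by (intro mult_mono nL) (use B in auto)
      finally show ?thesis by (simp add: power2_eq_square mult_ac)
    qed
    have PL: "(P *v (L *v e)) \<bullet> (L *v e) \<le> p * B\<^sup>2 * a\<^sup>2"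
    proof -
      have "(P *v (L *v e)) \<bullet> (L *v e) \<le> norm (P *v (L *v e)) * norm (L *v e)"
        by (rule norm_cauchy_schwarz)
      also have "\<dots> \<le> (norm (L *v e) * p) * norm (L *v e)"
        by (intro mult_right_mono p) simp
      also have "\<dots> = p * (norm (L *v e))\<^sup>2" by (simp add: power2_eq_square mult_ac)
      also have "\<dots> \<le> p * (B * a)\<^sup>2"
        using p nL[of e] by (intro mult_left_mono power_mono) (auto simp: a_def)
      finally show ?thesis by (simp add: power_mult_distrib mult.assoc)
    qed
    have cross: "(P *v (L *v e)) \<bullet> (L *v e) - (L *v e + v + m *\<^sub>R e) \<bullet> (L *v v)
       \<le> (p * B\<^sup>2 + g\<^sup>2 / (2 * \<mu>)) * a\<^sup>2 - \<mu> / 2 * b\<^sup>2"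
    proof -
      have "m * \<bar>e \<bullet> (L *v v)\<bar> \<le> m * (B * (a * b))"
        using ev m by (intro mult_left_mono) auto
      then have "- (m * (e \<bullet> (L *v v))) \<le> m * (B * (a * b))"
        using m by (smt (verit) mult_minus_right mult_left_mono)
      then have "(P *v (L *v e)) \<bullet> (L *v e) - (L *v e + v + m *\<^sub>R e) \<bullet> (L *v v)
          \<le> p * B\<^sup>2 * a\<^sup>2 + g * (a * b) - \<mu> * b\<^sup>2"
        using PL LL vv by (simp add: inner_add_left g_def distrib_right mult.assoc)
      moreover have "g * (a * b) \<le> g\<^sup>2 / (2 * \<mu>) * a\<^sup>2 + \<mu> / 2 * b\<^sup>2"
        using \<mu> zero_le_power2[of "g * a - \<mu> * b"]
        by (simp add: field_simps power2_eq_square)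
      ultimately show ?thesis by (simp add: algebra_simps)
    qed
    have S_cross: "S * ((P *v (L *v e)) \<bullet> (L *v e) - (L *v e + v + m *\<^sub>R e) \<bullet> (L *v v))
       \<le> C * a\<^sup>2 - (1 / \<mu> + 1) * b\<^sup>2"
    proof -
      have "S * (\<mu> / 2) = 1 / \<mu> + 1" using \<mu> by (simp add: S_def)
      then have "S * ((p * B\<^sup>2 + g\<^sup>2 / (2 * \<mu>)) * a\<^sup>2 - \<mu> / 2 * b\<^sup>2) = C * a\<^sup>2 - (1 / \<mu> + 1) * b\<^sup>2"
        by (simp add: C_def right_diff_distrib flip: mult.assoc)
      moreover have "S * ((P *v (L *v e)) \<bullet> (L *v e) - (L *v e + v + m *\<^sub>R e) \<bullet> (L *v v))
          \<le> S * ((p * B\<^sup>2 + g\<^sup>2 / (2 * \<mu>)) * a\<^sup>2 - \<mu> / 2 * b\<^sup>2)"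
        by (intro mult_left_mono cross) (use S in simp)
      ultimately show ?thesis by linarith
    qed
    have A_part: "A * (- 2 * ((L *v e) \<bullet> (L *v e)) - 2 * m * (e \<bullet> (L *v e))) \<le> - ((C + 1) * a\<^sup>2)"
    proof -
      have "- 2 * ((L *v e) \<bullet> (L *v e)) - 2 * m * (e \<bullet> (L *v e)) \<le> - (2 * m * (\<mu> * a\<^sup>2))"
        using mult_left_mono[OF ee(1), of "2 * m"] m inner_ge_zero[of "L *v e"] by linarith
      from mult_left_mono[OF this, of A] mult_right_mono[OF A1, of "a\<^sup>2"] A
      show ?thesis by (simp add: mult.assoc)
    qed
    have y_part: "- 2 * ((L *v y + v) \<bullet> deviation y) \<le> - \<mu> * d\<^sup>2 + 1 / \<mu> * b\<^sup>2"
    proof -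
      have "(L *v y) \<bullet> deviation y = y \<bullet> (L *v y)"
        by (metis inner_commute mult_deviation selfadjoint)
      moreover have "- (v \<bullet> deviation y) \<le> b * d"
        using Cauchy_Schwarz_ineq2[of "deviation v" "deviation y"] inner_deviation_left[of y v]
        by (simp add: b_def d_def inner_commute)
      moreover have "2 * (b * d) \<le> 1 / \<mu> * b\<^sup>2 + \<mu> * d\<^sup>2"
        using \<mu> zero_le_power2[of "b - \<mu> * d"]
        by (simp add: field_simps power2_eq_square)
      ultimately show ?thesis using yy by (simp add: inner_add_left)
    qed
    have "\<kappa> * ?W \<le> \<kappa> * (D * (a\<^sup>2 + b\<^sup>2 + d\<^sup>2))"
      using W_le \<mu> D by (intro mult_left_mono) (auto simp: \<kappa>_def)
    also have "\<dots> = min 1 \<mu> * a\<^sup>2 + min 1 \<mu> * b\<^sup>2 + min 1 \<mu> * d\<^sup>2"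
      using D by (simp add: \<kappa>_def algebra_simps)
    also have "\<dots> \<le> 1 * a\<^sup>2 + 1 * b\<^sup>2 + \<mu> * d\<^sup>2"
      by (intro add_mono mult_right_mono) auto
    finally have "\<kappa> * ?W \<le> a\<^sup>2 + b\<^sup>2 + \<mu> * d\<^sup>2" by simp
    with S_cross A_part y_part
    show "A * (- 2 * ((L *v e) \<bullet> (L *v e)) - 2 * m * (e \<bullet> (L *v e)))
       + S * ((P *v (L *v e)) \<bullet> (L *v e) - (L *v e + v + m *\<^sub>R e) \<bullet> (L *v v))
       - 2 * ((L *v y + v) \<bullet> deviation y) \<le> - \<kappa> * ?W"
      by (simp add: distrib_right)
  qed
qed

text \<open>
  The shift \<open>z = v - q 1\<close>, normalised by \<open>1 \<bullet> R z = 0\<close>, satisfies the same equations as \<open>v\<close> up to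
  multiples of \<open>1\<close>, which drop out of every term of the Lyapunov derivative.
\<close>

lemma deviation_tendsto_zero:
  fixes P R :: "real ^ 'n ^ 'n" and m c :: real
    and x v e :: "real \<Rightarrow> real ^ 'n"
  assumes m: "m > 0" and c: "c > 0"
    and R_sym: "\<And>u v. u \<bullet> (R *v v) = (R *v u) \<bullet> v"
    and R_pos: "\<And>v. c * (norm v)\<^sup>2 \<le> v \<bullet> (R *v v)"
    and RP: "\<And>v. R *v (P *v v) = v"
    and x': "\<And>t. t \<ge> 0 \<Longrightarrow> (x has_vector_derivative - (L *v x t) - v t) (at t within {0..})"
    and v': "\<And>t. t \<ge> 0 \<Longrightarrow> (v has_vector_derivative P *v (L *v e t)) (at t within {0..})"
    and e': "\<And>t. t \<ge> 0 \<Longrightarrow>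
      (e has_vector_derivative - (L *v e t) - v t - m *\<^sub>R e t) (at t within {0..})"
  shows "((\<lambda>t. deviation (x t)) \<longlongrightarrow> 0) at_top"
proof -
  obtain A S \<kappa> where \<kappa>: "\<kappa> > 0"
    and W_ge: "\<And>e v y :: real ^ 'n. (norm (deviation y))\<^sup>2
       \<le> A * (e \<bullet> (L *v e) + v \<bullet> (R *v v)) + S * (e \<bullet> (L *v v)) + y \<bullet> deviation y"
    and W'_le: "\<And>e v y. 1 \<bullet> (R *v v) = 0 \<Longrightarrow>
       A * (- 2 * ((L *v e) \<bullet> (L *v e)) - 2 * m * (e \<bullet> (L *v e)))
       + S * ((P *v (L *v e)) \<bullet> (L *v e) - (L *v e + v + m *\<^sub>R e) \<bullet> (L *v v))
       - 2 * ((L *v y + v) \<bullet> deviation y)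
       \<le> - \<kappa> * (A * (e \<bullet> (L *v e) + v \<bullet> (R *v v)) + S * (e \<bullet> (L *v v)) + y \<bullet> deviation y)"
    by (rule strict_lyapunov[OF m c R_sym R_pos, of P]) auto
  define q where "q = 1 \<bullet> (R *v v 0) / (1 \<bullet> (R *v 1))"
  define z where "z t = v t - q *\<^sub>R 1" for t
  have one_R_one: "1 \<bullet> (R *v 1) > 0"
    using R_pos[of 1] c by (smt (verit) one_neq_zero mult_pos_pos norm_eq_zero zero_less_power2)
  have v_z: "v t = z t + q *\<^sub>R 1" for t
    by (simp add: z_def)
  have L_z: "L *v z t = L *v v t" for t
    by (simp add: z_def matrix_vector_mult_diff_distrib matrix_vector_mult_scaleR mult_one)
  have z': "(z has_vector_derivative P *v (L *v e t)) (at t within {0..})" if "t \<ge> 0" for t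
    unfolding z_def using v'[OF that] by (auto intro!: derivative_eq_intros)
  \<comment> \<open>The derivative of \<open>1 \<bullet> R z\<close> is \<open>1 \<bullet> R P L e = 1 \<bullet> L e = 0\<close>, and \<open>q\<close> normalises the initial value.\<close>
  have orth: "1 \<bullet> (R *v z t) = 0" if t: "t \<ge> 0" for t
  proof -
    have "((\<lambda>t. 1 \<bullet> (R *v z t)) has_real_derivative 0) (at s within {0..})" if "s \<ge> 0" for s
      using has_real_derivative_inner[OF has_vector_derivative_const
          has_vector_derivative_matrix_mult[OF z'[OF that], of R], of 1]
      by (simp add: RP inner_one_mult)
    then have "\<exists>k. \<forall>s\<in>{0..}. 1 \<bullet> (R *v z s) = k"
      by (intro has_field_derivative_zero_constant) auto
    then have "1 \<bullet> (R *v z t) = 1 \<bullet> (R *v z 0)" using t by auto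
    also have "\<dots> = 0"
      using one_R_one
      by (simp add: z_def q_def matrix_vector_mult_diff_distrib matrix_vector_mult_scaleR inner_diff_right)
    finally show ?thesis .
  qed
  define W where "W t = A * (e t \<bullet> (L *v e t) + z t \<bullet> (R *v z t)) + S * (e t \<bullet> (L *v z t))
    + x t \<bullet> deviation (x t)" for t
  define W' where "W' t = A * (- 2 * ((L *v e t) \<bullet> (L *v e t)) - 2 * m * (e t \<bullet> (L *v e t)))
       + S * ((P *v (L *v e t)) \<bullet> (L *v e t) - (L *v e t + z t + m *\<^sub>R e t) \<bullet> (L *v z t))
       - 2 * ((L *v x t + z t) \<bullet> deviation (x t))" for t
  have W_deriv: "(W has_real_derivative W' t) (at t within {0..})" if t: "t \<ge> 0" for t
  proof -
    define de where "de = - (L *v e t) - v t - m *\<^sub>R e t"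
    define dz where "dz = P *v (L *v e t)"
    define dx where "dx = - (L *v x t) - v t"
    \<comment> \<open>The indefinite term \<open>2 (z \<bullet> L e)\<close> appears in \<open>ee\<close> and \<open>zz\<close> with opposite signs and cancels.\<close>
    have ee: "e t \<bullet> (L *v de) + de \<bullet> (L *v e t)
        = - 2 * ((L *v e t) \<bullet> (L *v e t)) - 2 * m * (e t \<bullet> (L *v e t)) - 2 * (z t \<bullet> (L *v e t))"
    proof -
      have "e t \<bullet> (L *v de) = de \<bullet> (L *v e t)"
        by (metis inner_commute selfadjoint)
      moreover have "v t \<bullet> (L *v e t) = z t \<bullet> (L *v e t)"
        by (simp add: selfadjoint L_z)
      ultimately show ?thesis
        by (simp add: de_def inner_diff_left algebra_simps)
    qed
    have zz: "z t \<bullet> (R *v dz) + dz \<bullet> (R *v z t) = 2 * (z t \<bullet> (L *v e t))"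
      using R_sym[of dz "z t"] by (simp add: dz_def RP inner_commute)
    have ez: "e t \<bullet> (L *v dz) + de \<bullet> (L *v z t)
        = (P *v (L *v e t)) \<bullet> (L *v e t) - (L *v e t + z t + m *\<^sub>R e t) \<bullet> (L *v z t)"
    proof -
      have "e t \<bullet> (L *v dz) = (P *v (L *v e t)) \<bullet> (L *v e t)"
        using selfadjoint[of "e t" dz] by (simp add: dz_def inner_commute)
      moreover have "de \<bullet> (L *v z t) = - ((L *v e t + z t + m *\<^sub>R e t) \<bullet> (L *v z t))"
        by (simp add: de_def v_z inner_add_left inner_diff_left inner_one_mult)
      ultimately show ?thesis by simp
    qed
    have dev': "((\<lambda>t. deviation (x t)) has_vector_derivative deviation dx) (at t within {0..})"
      unfolding dx_def
      by (rule bounded_linear.has_vector_derivative[OF bounded_linear_deviation x'[OF t]])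
    have xx: "x t \<bullet> deviation dx + dx \<bullet> deviation (x t) = - 2 * ((L *v x t + z t) \<bullet> deviation (x t))"
    proof -
      have "x t \<bullet> deviation dx = dx \<bullet> deviation (x t)"
        by (metis inner_commute inner_deviation_left)
      then show ?thesis
        by (simp add: dx_def v_z inner_diff_left inner_add_left inner_one_deviation)
    qed
    note D = e'[OF t, folded de_def] z'[OF t, folded dz_def] x'[OF t, folded dx_def]
    show ?thesis
      unfolding W_def W'_def
      apply (rule derivative_eq_intros refl
          has_real_derivative_inner[OF D(1) has_vector_derivative_matrix_mult[OF D(1)]]
          has_real_derivative_inner[OF D(2) has_vector_derivative_matrix_mult[OF D(2)]]
          has_real_derivative_inner[OF D(1) has_vector_derivative_matrix_mult[OF D(2)]]
          has_real_derivative_inner[OF D(3) dev'])+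
      unfolding ee zz ez xx
      by (simp add: algebra_simps)
  qed
  have bound: "(norm (deviation (x t)))\<^sup>2 \<le> W 0 * exp (- \<kappa> * t)" if "t \<ge> 0" for t
  proof -
    have "W t \<le> W 0 * exp (- \<kappa> * t)"
      using W'_le[OF orth] by (intro exponential_decay[OF W_deriv _ that]) (auto simp: W_def W'_def)
    with W_ge[of "x t" "e t" "z t"] show ?thesis by (simp add: W_def)
  qed
  have "((\<lambda>t. W 0 * exp (- \<kappa> * t)) \<longlongrightarrow> 0) at_top"
  proof -
    have "filterlim (\<lambda>t. - \<kappa> * t) at_bot at_top"
      using filterlim_tendsto_pos_mult_at_top[OF tendsto_const \<kappa> filterlim_ident]
      by (simp flip: filterlim_uminus_at_top)
    then have "((\<lambda>t. exp (- \<kappa> * t)) \<longlongrightarrow> 0) at_top"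
      by (rule filterlim_compose[OF exp_at_bot])
    then show ?thesis by (rule tendsto_mult_right_zero)
  qed
  then have "((\<lambda>t. (norm (deviation (x t)))\<^sup>2) \<longlongrightarrow> 0) at_top"
    by (rule Lim_null_comparison[rotated])
      (use bound in \<open>auto simp: eventually_at_top_linorder intro!: exI[of _ 0]\<close>)
  then have "((\<lambda>t. norm (deviation (x t))) \<longlongrightarrow> 0) at_top"
    by (auto dest: tendsto_real_sqrt)
  then show ?thesis by (simp add: tendsto_norm_zero_iff)
qed

end

section \<open>Consensus of the multiagent system\<close>

theorem mainTheorem2:
  fixes G :: "'n::finite pair_pre_digraph"
    and w x\<^sub>0 w_hat\<^sub>0 x_hat\<^sub>0 k :: "real ^ 'n"
    and K M :: "real ^ 'n ^ 'n"
    and m :: real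
    and x u w_hat x_hat w_tilde :: "real \<Rightarrow> real ^ 'n"
  assumes "pair_graph G" and "pverts G = UNIV"
    and "Digraph_Component.connected (with_proj G)"
    and "K = diag_matrix k" and "\<And>i. k $ i > 0"
    and "M = m *\<^sub>R mat 1" and "m > 0"
    and "\<And>t. t \<ge> 0 \<Longrightarrow> (x has_vector_derivative u t + w) (at t within {0..})"
    and "x 0 = x\<^sub>0"
    and "\<And>t. t \<ge> 0 \<Longrightarrow> u t = - (laplacian_matrix G *v x t) - w_hat t"
    and "\<And>t. t \<ge> 0 \<Longrightarrow>
          (w_hat has_vector_derivative (K ** Q_matrix G) *v (x t - x_hat t)) (at t within {0..})"
    and "w_hat 0 = w_hat\<^sub>0"
    and "\<And>t. t \<ge> 0 \<Longrightarrow>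
          (x_hat has_vector_derivative - (laplacian_matrix G *v x_hat t) + M *v (x t - x_hat t))
            (at t within {0..})"
    and "x_hat 0 = x_hat\<^sub>0"
    and "\<And>t. t \<ge> 0 \<Longrightarrow> w_tilde t = w_hat t - w"
  shows "((\<lambda>t. x t - (1 \<bullet> x\<^sub>0 - 1 \<bullet> integral {0..t} w_tilde) *\<^sub>R ((1 / real CARD('n)) *\<^sub>R 1))
            \<longlongrightarrow> 0) at_top"
proof -
  note sym = sym_parcs_pair_graph[OF assms(1)]
  let ?L = "laplacian_matrix G"
  obtain \<mu> where \<mu>: "\<mu> > 0"
    "\<And>v. 1 \<bullet> v = 0 \<Longrightarrow> \<mu> * (norm v)\<^sup>2 \<le> v \<bullet> (?L *v v)"
    by (rule laplacian_spectral_gap[OF sym assms(2,3)]) blast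
  interpret laplacian_like ?L \<mu>
    using \<mu> by unfold_locales (simp_all add: laplacian_selfadjoint[OF sym] laplacian_mult_one)
  define p :: "real ^ 'n" where "p = (\<chi> i. k $ i / (real (card (neighbors G i)) + 1))"
  define \<rho> :: "real ^ 'n" where "\<rho> = (\<chi> i. 1 / p $ i)"
  have p: "p $ i > 0" for i
    using assms(5)[of i] by (simp add: p_def add_nonneg_pos)
  have KQ: "(K ** Q_matrix G) *v v = diag_matrix p *v (?L *v v)" for v
    by (simp add: vec_eq_iff assms(4) Q_matrix_eq S_matrix_def diag_matrix_mult_nth p_def divide_inverse
        flip: matrix_vector_mul_assoc)
  have inv: "diag_matrix \<rho> *v (diag_matrix p *v v) = v" for v
    using p by (simp add: vec_eq_iff diag_matrix_mult_nth \<rho>_def less_imp_neq[symmetric])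
  obtain c where c: "c > 0" "\<And>v. c * (norm v)\<^sup>2 \<le> v \<bullet> (diag_matrix \<rho> *v v)"
    using p by (rule_tac diag_matrix_coercive[of \<rho>]) (auto simp: \<rho>_def)
  have x': "(x has_vector_derivative - (?L *v x t) - (w_hat t - w)) (at t within {0..})"
    if "t \<ge> 0" for t
    using assms(8)[OF that] assms(10)[OF that] by (simp add: algebra_simps)
  have w': "((\<lambda>t. w_hat t - w) has_vector_derivative diag_matrix p *v (?L *v (x t - x_hat t)))
      (at t within {0..})" if "t \<ge> 0" for t
    using assms(11)[OF that] by (auto intro!: derivative_eq_intros simp: KQ)
  have e': "((\<lambda>t. x t - x_hat t) has_vector_derivative
      - (?L *v (x t - x_hat t)) - (w_hat t - w) - m *\<^sub>R (x t - x_hat t)) (at t within {0..})"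
    if "t \<ge> 0" for t
    using has_vector_derivative_diff[OF x'[OF that] assms(13)[OF that]]
    by (simp add: assms(6) scaleR_matrix_vector_assoc[symmetric] matrix_vector_mult_diff_distrib algebra_simps)
  have lim: "((\<lambda>t. deviation (x t)) \<longlongrightarrow> 0) at_top"
    by (rule deviation_tendsto_zero[OF assms(7) c(1) inner_diag_matrix c(2) inv x' w' e'])
  have mean: "1 \<bullet> x t = 1 \<bullet> x\<^sub>0 - 1 \<bullet> integral {0..t} w_tilde" if t: "t \<ge> 0" for t
  proof -
    have "((\<lambda>s. 1 \<bullet> x s) has_vector_derivative - (1 \<bullet> w_tilde s)) (at s within {0..t})"
      if s: "s \<in> {0..t}" for s
    proof -
      have "((\<lambda>s. 1 \<bullet> x s) has_vector_derivative 1 \<bullet> (- (?L *v x s) - (w_hat s - w))) (at s within {0..})"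
        using s by (intro bounded_linear.has_vector_derivative[OF bounded_linear_inner_right] x') auto
      moreover have "1 \<bullet> (- (?L *v x s) - (w_hat s - w)) = - (1 \<bullet> w_tilde s)"
        using s by (simp add: assms(15) inner_diff_right inner_one_mult)
      ultimately show ?thesis
        by (auto intro: has_vector_derivative_within_subset)
    qed
    then have "((\<lambda>s. - (1 \<bullet> w_tilde s)) has_integral 1 \<bullet> x t - 1 \<bullet> x 0) {0..t}"
      by (rule fundamental_theorem_of_calculus[OF t])
    moreover have "((\<lambda>s. - (1 \<bullet> w_tilde s)) has_integral - (1 \<bullet> integral {0..t} w_tilde)) {0..t}"
    proof -
      have "continuous_on {0..} (\<lambda>s. w_hat s - w)"
        using w' by (auto simp: continuous_on_eq_continuous_within intro: has_vector_derivative_continuous)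
      then have "continuous_on {0..t} (\<lambda>s. w_hat s - w)" by (rule continuous_on_subset) auto
      then have "continuous_on {0..t} w_tilde"
        by (rule continuous_on_eq) (simp add: assms(15))
      then have "(w_tilde has_integral integral {0..t} w_tilde) {0..t}"
        by (intro integrable_integral integrable_continuous_real)
      then show ?thesis
        by (intro has_integral_neg has_integral_linear[OF _ bounded_linear_inner_right, unfolded o_def])
    qed
    ultimately have "1 \<bullet> x t - 1 \<bullet> x 0 = - (1 \<bullet> integral {0..t} w_tilde)"
      by (rule has_integral_unique)
    then show ?thesis by (simp add: assms(9))
  qed
  have "\<forall>\<^sub>F t in at_top. deviation (x t)
      = x t - (1 \<bullet> x\<^sub>0 - 1 \<bullet> integral {0..t} w_tilde) *\<^sub>R ((1 / real CARD('n)) *\<^sub>R 1)"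
    using eventually_ge_at_top[of 0] by eventually_elim (simp add: deviation_def mean)
  then show ?thesis by (rule Lim_transform_eventually[OF lim])
qed

end
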